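(* Let $R$ be a Lie nilpotent algebra of index $k\ge1$ over a field $K$ of characteristic zero, let $n\ge 1$ and let $e\in K$ be a primitive $n$-th root of unity. If $\delta:R\to R$ is a $K$-automorphism ($K\subseteq\mathrm{Fix}(\delta)$) with $\delta^n=\mathrm{id}_R$, then $R$ is right (and left) integral over $\mathrm{Fix}(\delta)$ of degree $n^k$. In other words, for any $r\in R$ we have $$c_0'+rc_1'+\cdots+r^{n^k-1}c_{n^k-1}'+r^{n^k}=0=c_0''+c_1''r+\cdots+c_{n^k-1}''r^{n^k-1}+r^{n^k}$$ for some $c_i',c_i''\in\mathrm{Fix}(\delta)$, $0\le i\le n^k-1$.
   Context: Algebras are associative, not necessarily commutative, with identity; endomorphisms preserve the identity. $\mathrm{Fix}(\delta)=\{r\in R\mid\delta(r)=r\}$. $R$ is Lie nilpotent of index $k$ if it satisfies the polynomial identity $[[[\ldots[[x_1,x_2],x_3],\ldots],x_k],x_{k+1}]=0$, where $[x,y]=xy-yx$. A primitive $n$-th root of unity $e\in K$ satisfies $e^n=1$ and $e^j\neq1$ for all $1\le j\le n-1$. *)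

theory Defs
  imports Complex_Main
begin

text \<open>
  A unital associative, not necessarily commutative, algebra over a field. The class
  \<^class>\<open>ring_1\<close> forces \<open>0 \<noteq> 1\<close>, which is what makes \<open>c \<mapsto> c \<cdot> 1\<close> an embedding of the
  field into the algebra.
\<close>

locale unital_algebra = vector_space scale
  for scale :: "'k::field \<Rightarrow> 'a::ring_1 \<Rightarrow> 'a" +
  assumes scale_mult_left: "scale c x * y = scale c (x * y)"
    and scale_mult_right: "x * scale c y = scale c (x * y)"

definition lie_bracket :: "'a::ring_1 \<Rightarrow> 'a \<Rightarrow> 'a"
  where "lie_bracket x y = x * y - y * x"

text \<open>
  With the variables numbered from 0, \<open>iterated_bracket x k\<close> is the left-normed commutator of
  the \<open>k + 1\<close> elements \<open>x 0, \<dots>, x k\<close>; it involves \<open>k\<close> brackets.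
\<close>

primrec iterated_bracket :: "(nat \<Rightarrow> 'a::ring_1) \<Rightarrow> nat \<Rightarrow> 'a"
  where
    "iterated_bracket x 0 = x 0"
  | "iterated_bracket x (Suc k) = lie_bracket (iterated_bracket x k) (x (Suc k))"

definition lie_nilpotent :: "'a::ring_1 itself \<Rightarrow> nat \<Rightarrow> bool"
  where "lie_nilpotent T k \<longleftrightarrow> (\<forall>x :: nat \<Rightarrow> 'a. iterated_bracket x k = 0)"

definition primitive_root_of_unity :: "nat \<Rightarrow> 'k::field \<Rightarrow> bool"
  where "primitive_root_of_unity n e \<longleftrightarrow> e ^ n = 1 \<and> (\<forall>j\<in>{1..n - 1}. e ^ j \<noteq> 1)"

definition Fix :: "('a \<Rightarrow> 'a) \<Rightarrow> 'a set"
  where "Fix \<delta> = {r. \<delta> r = r}"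

definition ring_automorphism :: "('a::ring_1 \<Rightarrow> 'a) \<Rightarrow> bool"
  where "ring_automorphism \<delta> \<longleftrightarrow> bij \<delta> \<and> \<delta> 1 = 1
    \<and> (\<forall>x y. \<delta> (x + y) = \<delta> x + \<delta> y) \<and> (\<forall>x y. \<delta> (x * y) = \<delta> x * \<delta> y)"

text \<open>
  The field is identified with its image \<open>{c \<cdot> 1}\<close> in the algebra; for a ring automorphism,
  fixing this image pointwise is the same as being linear over the field.
\<close>

definition algebra_automorphism :: "('k::field \<Rightarrow> 'a::ring_1 \<Rightarrow> 'a) \<Rightarrow> ('a \<Rightarrow> 'a) \<Rightarrow> bool"
  where "algebra_automorphism scale \<delta> \<longleftrightarrow>
    ring_automorphism \<delta> \<and> range (\<lambda>c. scale c 1) \<subseteq> Fix \<delta>"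

text \<open>
  The whole ring \<open>'a\<close> is integral over its subset \<open>S\<close>, of the uniform degree \<open>d\<close>; ``right'' and
  ``left'' refer to the side on which the coefficients stand.
\<close>

definition right_integral_of_degree :: "'a::ring_1 set \<Rightarrow> nat \<Rightarrow> bool"
  where "right_integral_of_degree S d \<longleftrightarrow>
    (\<forall>r. \<exists>c. (\<forall>i<d. c i \<in> S) \<and> (\<Sum>i<d. r ^ i * c i) + r ^ d = 0)"

definition left_integral_of_degree :: "'a::ring_1 set \<Rightarrow> nat \<Rightarrow> bool"
  where "left_integral_of_degree S d \<longleftrightarrow>
    (\<forall>r. \<exists>c. (\<forall>i<d. c i \<in> S) \<and> (\<Sum>i<d. c i * r ^ i) + r ^ d = 0)"

end

theory Submission
  imports Defs "HOL-Computational_Algebra.Formal_Power_Series"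
begin

text \<open>
  Put \<open>N f = f \<cdot> \<delta> f \<cdots> \<delta>\<^sup>n\<^sup>-\<^sup>1 f\<close>. Moving the first factor to the end shows that
  \<open>\<delta> (N f) - N f\<close> is a commutator. Hence \<open>N f\<close> and all its conjugates lie in the subring \<open>U\<close>
  generated by \<open>N f\<close> and the commutators, and \<open>U\<close> is Lie nilpotent of index one less than the
  given ring (a consequence of Latyshev's inclusion of the product of the ideals generated by
  \<open>a\<close>-fold and \<open>b\<close>-fold commutators in the one generated by \<open>(a + b - 1)\<close>-fold ones).
  By induction \<open>N\<^sup>k f\<close> is fixed by \<open>\<delta>\<close>. Applied to \<open>f = 1 - r X\<close> over the power series ring this
  gives a polynomial of degree \<open>n\<^sup>k\<close> with fixed coefficients, divisible by \<open>1 - r X\<close> on both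
  sides; its reversal annihilates \<open>r\<close>.
\<close>

section \<open>The lower central series of a subring\<close>

lemma lie_bracket_simps:
  "lie_bracket (x - y) z = lie_bracket x z - lie_bracket y z"
  "lie_bracket z (x - y) = lie_bracket z x - lie_bracket z y"
  "lie_bracket 0 z = 0" "lie_bracket z 0 = 0"
  "lie_bracket 1 z = 0" "lie_bracket z 1 = 0" "lie_bracket z z = 0"
  by (simp_all add: lie_bracket_def algebra_simps)

lemma lie_bracket_mult_left: "lie_bracket (x * y) z = x * lie_bracket y z + lie_bracket x z * y"
  by (simp add: lie_bracket_def algebra_simps)

lemma lie_bracket_mult_right: "lie_bracket z (x * y) = lie_bracket z x * y + x * lie_bracket z y"
  by (simp add: lie_bracket_def algebra_simps)

lemma lie_bracket_swap: "lie_bracket x y = - lie_bracket y x"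
  by (simp add: lie_bracket_def)

lemma lie_bracket_jacobi:
  "lie_bracket x (lie_bracket u y) = lie_bracket (lie_bracket x u) y - lie_bracket (lie_bracket x y) u"
  by (simp add: lie_bracket_def algebra_simps)


text \<open>Term \<open>m\<close> of the lower central series of \<open>S\<close> as a Lie ring;
  \<open>m\<close> counts brackets, not entries.\<close>

inductive lower_central :: "'a::ring_1 set \<Rightarrow> nat \<Rightarrow> 'a \<Rightarrow> bool" for S where
  base: "x \<in> S \<Longrightarrow> lower_central S 0 x"
| bracket: "lower_central S m u \<Longrightarrow> x \<in> S \<Longrightarrow> lower_central S (Suc m) (lie_bracket u x)"
| zero: "lower_central S m 0"
| diff: "lower_central S m u \<Longrightarrow> lower_central S m v \<Longrightarrow> lower_central S m (u - v)"

lemma lower_central_uminus: "lower_central S m x \<Longrightarrow> lower_central S m (- x)"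
  using lower_central.diff[OF lower_central.zero, of S m x] by simp

lemma lower_central_add:
  "lower_central S m x \<Longrightarrow> lower_central S m y \<Longrightarrow> lower_central S m (x + y)"
  using lower_central.diff[of S m x "- y"] lower_central_uminus by auto

lemma lower_central_sum:
  "(\<And>i. i \<in> A \<Longrightarrow> lower_central S m (g i)) \<Longrightarrow> lower_central S m (sum g A)"
  by (induction A rule: infinite_finite_induct)
    (auto intro: lower_central.zero lower_central_add)

lemma iterated_bracket_head_diff:
  "iterated_bracket (case_nat (u - v) x) j =
    iterated_bracket (case_nat u x) j - iterated_bracket (case_nat v x) j"
  by (induction j) (simp_all add: lie_bracket_simps)

lemma iterated_bracket_head_bracket:
  "iterated_bracket (case_nat (lie_bracket u y) x) j =
    iterated_bracket (case_nat u (case_nat y x)) (Suc j)"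
  by (induction j) simp_all

lemma lower_central_lie_nilpotent:
  fixes z :: "'a::ring_1"
  assumes "lie_nilpotent TYPE('a) k" and "lower_central UNIV k z"
  shows "z = 0"
proof -
  \<comment> \<open>The \<open>m\<close> brackets inside \<open>z\<close> are handed over one by one
    to the variables \<open>x\<close>, so \<open>m + j\<close> stays \<open>k\<close>.\<close>
  have "iterated_bracket (case_nat z x) j = 0" if "lower_central UNIV m z" "m + j = k"
    for z :: 'a and x m j
    using that
  proof (induction arbitrary: x j rule: lower_central.induct)
    case (base z)
    then show ?case
      using assms(1) by (simp add: lie_nilpotent_def)
  next
    case (bracket m u y)
    then show ?case
      by (simp add: iterated_bracket_head_bracket del: iterated_bracket.simps)
  next
    case (zero m)
    then show ?case
      using iterated_bracket_head_diff[of 0 0 x j] by simp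
  qed (simp add: iterated_bracket_head_diff)
  from this[of k z 0] assms(2) show ?thesis
    by simp
qed

section \<open>Brackets inside a unital subring\<close>

locale unital_subring =
  fixes S :: "'a::ring_1 set"
  assumes one_closed: "1 \<in> S"
    and diff_closed: "x \<in> S \<Longrightarrow> y \<in> S \<Longrightarrow> x - y \<in> S"
    and mult_closed: "x \<in> S \<Longrightarrow> y \<in> S \<Longrightarrow> x * y \<in> S"
begin

lemma bracket_closed: "x \<in> S \<Longrightarrow> y \<in> S \<Longrightarrow> lie_bracket x y \<in> S"
  by (simp add: lie_bracket_def diff_closed mult_closed)

lemma zero_closed: "0 \<in> S"
  using diff_closed[OF one_closed one_closed] by simp

lemma lower_central_closed: "lower_central S m x \<Longrightarrow> x \<in> S"
  by (induction rule: lower_central.induct) (auto intro: bracket_closed zero_closed diff_closed)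

lemma lower_central_SucD: "lower_central S (Suc m) x \<Longrightarrow> lower_central S m x"
proof (induction "Suc m" x arbitrary: m rule: lower_central.induct)
  case (bracket m u x)
  then show ?case
    by (cases m) (auto intro: lower_central.intros bracket_closed lower_central_closed)
qed (auto intro: lower_central.intros)

text \<open>By the Jacobi identity, induction on the right argument reduces to brackets with single
  elements of \<open>S\<close>.\<close>

lemma lower_central_bracket:
  "lower_central S b y \<Longrightarrow> lower_central S a x \<Longrightarrow> lower_central S (Suc (a + b)) (lie_bracket x y)"
proof (induction arbitrary: a x rule: lower_central.induct)
  case (bracket m u y)
  have "lower_central S (Suc (Suc (a + m))) (lie_bracket (lie_bracket x u) y)"
    by (intro lower_central.bracket bracket)
  moreover from bracket.IH[OF lower_central.bracket[OF bracket.prems bracket.hyps(2)]]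
  have "lower_central S (Suc (Suc (a + m))) (lie_bracket (lie_bracket x y) u)"
    by simp
  ultimately show ?case
    by (simp add: lie_bracket_jacobi lower_central.diff)
qed (auto intro: lower_central.intros simp: lie_bracket_simps)

text \<open>The same Jacobi argument, asking depth only of the brackets of \<open>x\<close>: meant
  for products such as \<open>a * u\<close>, which need not lie deep themselves.\<close>

lemma lower_central_bracket_ideal_aux:
  assumes "lower_central S k w"
    and "\<And>b. b \<in> S \<Longrightarrow> lower_central S j (lie_bracket x b)"
  shows "lower_central S (j + k) (lie_bracket x w)"
  using assms(1)
proof (induction rule: lower_central.induct)
  case (bracket m u y)
  have "lower_central S (Suc (j + m)) (lie_bracket (lie_bracket x u) y)"
    using bracket by (intro lower_central.bracket)
  moreover have "lower_central S (Suc (j + m)) (lie_bracket (lie_bracket x y) u)"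
    using bracket assms(2) by (intro lower_central_bracket)
  ultimately show ?case
    by (simp add: lie_bracket_jacobi lower_central.diff)
qed (auto intro: lower_central.intros assms(2) simp: lie_bracket_simps)

text \<open>A factor \<open>a\<close> may destroy the depth of \<open>u\<close>, but one bracket
  restores it. This is the key to Latyshev's inclusion.\<close>

lemma lower_central_bracket_mult:
  assumes "lower_central S j u" "a \<in> S" "b \<in> S"
  shows "lower_central S j (lie_bracket (a * u) b)"
  using assms
proof (induction j arbitrary: a b u)
  case 0
  then show ?case
    using lower_central_closed[of 0 u]
    by (simp add: lower_central.base bracket_closed mult_closed)
next
  case (Suc j)
  from Suc.prems show ?case
  proof (induction "Suc j" u rule: lower_central.induct)
    case (bracket v g)
    note [simp] = \<open>a \<in> S\<close> \<open>b \<in> S\<close> \<open>g \<in> S\<close> \<open>lower_central S j v\<close>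
    have v: "v \<in> S"
      by (rule lower_central_closed) fact
    define x where "x = lie_bracket a g"
    have x: "lower_central S (Suc 0) x"
      unfolding x_def by (intro lower_central.intros) auto
    have 1: "lower_central S (Suc j) (lie_bracket (lie_bracket (a * v) g) b)"
      by (intro lower_central.bracket Suc.IH) auto
    \<comment> \<open>The induction hypothesis needs \<open>b\<close> on the left of
      \<open>v\<close>; the correction \<open>[[v, b], c]\<close> is two brackets deeper than
      \<open>v\<close>.\<close>
    have "lower_central S j (lie_bracket (v * b) c)" if "c \<in> S" for c
    proof -
      have "lie_bracket (v * b) c = lie_bracket (b * v) c + lie_bracket (lie_bracket v b) c"
        by (simp add: lie_bracket_def algebra_simps)
      moreover have "lower_central S j (lie_bracket (lie_bracket v b) c)"
        using that by (simp add: lower_central_SucD lower_central.bracket)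
      ultimately show ?thesis
        using that by (simp add: lower_central_add Suc.IH)
    qed
    then have 2: "lower_central S (Suc j) (lie_bracket (v * b) x)"
      using lower_central_bracket_ideal_aux[OF x, of j "v * b"] by simp
    have "b * x \<in> S"
      using lower_central_closed[OF x] by (simp add: mult_closed)
    then have 3: "lower_central S (Suc j) (lie_bracket v (b * x))"
      by (intro lower_central.bracket) auto
    \<comment> \<open>This combines \<open>[xv, b] + [vb, x] + [bx, v] = 0\<close> with \<open>a[v, g] = [av, g] - xv\<close>.\<close>
    have "lie_bracket (a * lie_bracket v g) b =
        lie_bracket (lie_bracket (a * v) g) b + lie_bracket (v * b) x - lie_bracket v (b * x)"
      by (simp add: x_def lie_bracket_def algebra_simps)
    then show ?case
      by (simp only:) (intro lower_central_add lower_central.diff 1 2 3)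
  qed (simp_all add: right_diff_distrib lie_bracket_simps lower_central.zero lower_central.diff)
qed

lemma lower_central_bracket_ideal:
  assumes "lower_central S j u" "a \<in> S" "lower_central S k w"
  shows "lower_central S (j + k) (lie_bracket w (a * u))"
  using lower_central_uminus[OF lower_central_bracket_ideal_aux[OF assms(3), of j "a * u"]]
    lower_central_bracket_mult assms lie_bracket_swap[of w "a * u"] by auto

section \<open>Ideals generated by terms of the series\<close>

inductive central_ideal :: "nat \<Rightarrow> 'a \<Rightarrow> bool" for m where
  mult: "s \<in> S \<Longrightarrow> lower_central S m z \<Longrightarrow> central_ideal m (s * z)"
| zero: "central_ideal m 0"
| diff: "central_ideal m x \<Longrightarrow> central_ideal m y \<Longrightarrow> central_ideal m (x - y)"

lemma central_ideal_add: "central_ideal m x \<Longrightarrow> central_ideal m y \<Longrightarrow> central_ideal m (x + y)"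
  using central_ideal.diff[of m x "0 - y"] central_ideal.diff[OF central_ideal.zero, of m y] by simp

lemma central_ideal_lower_central: "lower_central S m x \<Longrightarrow> central_ideal m x"
  using central_ideal.mult[OF one_closed] by simp

lemma central_ideal_mult_left: "central_ideal m x \<Longrightarrow> s \<in> S \<Longrightarrow> central_ideal m (s * x)"
  by (induction rule: central_ideal.induct)
    (auto simp: algebra_simps simp flip: mult.assoc intro: central_ideal.intros mult_closed)

text \<open>The ideal, generated on the left only, is two-sided:
  \<open>z * t = t * z + [z, t]\<close>, and \<open>[z, t]\<close> is deeper than
  \<open>z\<close>.\<close>

lemma central_ideal_mult_right: "central_ideal m x \<Longrightarrow> t \<in> S \<Longrightarrow> central_ideal m (x * t)"
proof (induction rule: central_ideal.induct)
  case (mult s z)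
  have "s * z * t = (s * t) * z + s * lie_bracket z t"
    by (simp add: lie_bracket_def algebra_simps)
  with mult show ?case
    by (simp add: central_ideal_add central_ideal.mult mult_closed
        lower_central_SucD lower_central.bracket)
qed (auto simp: algebra_simps intro: central_ideal.intros)

text \<open>On a generator, \<open>[w, c] * u = [w, c * u] - c * [w, u]\<close>;
  \<open>lower_central_bracket_ideal\<close> handles the first bracket, and the second has depth
  \<open>a + b + 1\<close>.\<close>

lemma lower_central_mult:
  assumes "lower_central S (Suc a) x" "lower_central S b u"
  shows "central_ideal (a + b) (x * u)"
  using assms
proof (induction "Suc a" x rule: lower_central.induct)
  case (bracket w c)
  have "lower_central S (a + b) (lie_bracket w u)"
    using bracket by (simp add: lower_central_SucD lower_central_bracket)
  then have "central_ideal (a + b) (c * lie_bracket w u)"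
    using bracket by (auto intro: central_ideal.mult)
  moreover have "central_ideal (a + b) (lie_bracket w (c * u))"
    using bracket lower_central_bracket_ideal[of b u c a w]
    by (auto intro: central_ideal_lower_central simp: add.commute)
  ultimately show ?case
    using central_ideal.diff[of "a + b" "lie_bracket w (c * u)" "c * lie_bracket w u"]
    by (simp add: lie_bracket_mult_right)
qed (auto simp: algebra_simps intro: central_ideal.intros)

text \<open>Latyshev's inclusion; \<open>Suc a\<close> against \<open>a + b\<close> expresses the
  loss of one bracket without subtraction.\<close>

lemma central_ideal_mult:
  assumes "central_ideal (Suc a) x" "central_ideal b y"
  shows "central_ideal (a + b) (x * y)"
  using assms(2,1)
proof (induction arbitrary: x rule: central_ideal.induct)
  case (mult t z)
  have "central_ideal (a + b) (x * z)" if "central_ideal (Suc a) x" for x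
    using that
  proof (induction rule: central_ideal.induct)
    case (mult s v)
    then show ?case
      using \<open>lower_central S b z\<close>
      by (simp add: mult.assoc central_ideal_mult_left lower_central_mult)
  qed (simp_all add: left_diff_distrib central_ideal.zero central_ideal.diff)
  from this[of "x * t"] mult show ?case
    by (simp add: mult.assoc central_ideal_mult_right)
qed (simp_all add: right_diff_distrib central_ideal.zero central_ideal.diff)

lemma central_ideal_trivial:
  assumes "central_ideal m x" "\<And>z. lower_central S m z \<Longrightarrow> z = 0"
  shows "x = 0"
  using assms(1) by (induction rule: central_ideal.induct) (auto dest: assms(2))

section \<open>Lowering the index of Lie nilpotency\<close>

text \<open>
  Degree 0 is the subring generated by \<open>h\<close> and the commutators. As \<open>h\<close> commutes with itself, every
  commutator of generators involves an element of the lower central series already, which is why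
  degree \<open>j\<close> is matched with \<open>j + 1\<close> brackets.
\<close>

inductive graded :: "'a \<Rightarrow> nat \<Rightarrow> 'a \<Rightarrow> bool" for h where
  one: "graded h 0 1"
| self: "graded h 0 h"
| lower_central: "lower_central S (Suc j) z \<Longrightarrow> graded h j z"
| mult: "graded h i x \<Longrightarrow> graded h j y \<Longrightarrow> graded h (i + j) (x * y)"
| diff: "graded h j x \<Longrightarrow> graded h j y \<Longrightarrow> graded h j (x - y)"

lemma graded_zero: "graded h j 0"
  by (intro graded.lower_central lower_central.zero)

lemma graded_uminus: "graded h j x \<Longrightarrow> graded h j (- x)"
  using graded.diff[OF graded_zero, of h j x] by simp

lemma graded_add: "graded h j x \<Longrightarrow> graded h j y \<Longrightarrow> graded h j (x + y)"
  using graded.diff[of h j x "- y"] graded_uminus by auto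

lemma graded_closed: "graded h j x \<Longrightarrow> h \<in> S \<Longrightarrow> x \<in> S"
  by (induction rule: graded.induct)
    (auto intro: one_closed lower_central_closed mult_closed diff_closed)

lemma graded_bracket_generator:
  assumes "graded h j x" "h \<in> S" "y = h \<or> lower_central S (Suc 0) y"
  shows "graded h (Suc j) (lie_bracket x y)"
  using assms
proof (induction rule: graded.induct)
  case self
  \<comment> \<open>For \<open>y = h\<close> the bracket vanishes; otherwise \<open>y\<close> lies
    at depth 1, so \<open>[y, h]\<close> lies at depth 2, that is, in degree 1.\<close>
  have "graded h 1 (- lie_bracket y h)" if "lower_central S (Suc 0) y"
    using self that
    by (intro graded_uminus graded.lower_central) (auto intro: lower_central.bracket)
  with self show ?case
    by (auto simp: lie_bracket_simps graded_zero simp flip: lie_bracket_swap)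
next
  case (lower_central j z)
  then show ?case
    by (auto intro!: graded.lower_central lower_central.bracket intro: lower_central_closed)
next
  case (mult i x j x')
  then show ?case
    using graded.mult[of h i x "Suc j" "lie_bracket x' y"]
      graded.mult[of h "Suc i" "lie_bracket x y" j x']
    by (simp add: lie_bracket_mult_left graded_add)
qed (auto simp: lie_bracket_simps intro: graded_zero graded.diff)

lemma graded_bracket:
  assumes "graded h 0 y" "graded h j x" "h \<in> S"
  shows "graded h (Suc j) (lie_bracket x y)"
  using assms
proof (induction "0::nat" y rule: graded.induct)
  case (mult i y j' y')
  then show ?case
    using graded.mult[of h "Suc j" "lie_bracket x y" 0 y']
      graded.mult[of h 0 y "Suc j" "lie_bracket x y'"]
    by (simp add: lie_bracket_mult_right graded_add)
qed (auto simp: lie_bracket_simps intro: graded_zero graded.diff graded_bracket_generator)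

text \<open>Factors of positive degrees \<open>i\<close> and \<open>j\<close> lie in the ideals
  \<open>i + 1\<close> and \<open>j + 1\<close>, so Latyshev's inclusion costs only the surplus
  bracket. Factors of degree 0 are absorbed as elements of \<open>S\<close>.\<close>

lemma graded_central_ideal:
  assumes "graded h j x" "h \<in> S" "j > 0"
  shows "central_ideal (Suc j) x"
  using assms
proof (induction rule: graded.induct)
  case (mult i x j y)
  then have "x \<in> S" "y \<in> S"
    using graded_closed[of h i x] graded_closed[of h j y] by simp_all
  consider "i = 0" "j > 0" | "i > 0" "j = 0" | "i > 0" "j > 0"
    using mult.prems by auto
  then show ?case
  proof cases
    case 3
    then show ?thesis
      using mult central_ideal_mult[of i x "Suc j" y] by simp
  qed (use mult \<open>x \<in> S\<close> \<open>y \<in> S\<close> in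
      \<open>simp_all add: central_ideal_mult_left central_ideal_mult_right\<close>)
qed (auto intro: central_ideal_lower_central central_ideal.diff)

lemma lower_central_graded:
  assumes "lower_central {x. graded h 0 x} j x" "h \<in> S"
  shows "graded h j x"
  using assms
  by (induction rule: lower_central.induct) (auto intro: graded_bracket graded_zero graded.diff)

lemma unital_subring_graded: "unital_subring {x. graded h 0 x}"
  using graded.mult[of h 0 _ 0] by unfold_locales (simp_all add: graded.one graded.diff)

text \<open>The drop in index: term \<open>k\<close> of the generated subring has degree
  \<open>k\<close>, hence lies in the ideal of term \<open>k + 1\<close> of
  \<open>S\<close>.\<close>

lemma lower_central_graded_trivial:
  assumes "\<And>z. lower_central S (Suc k) z \<Longrightarrow> z = 0" "k > 0" "h \<in> S"
    and "lower_central {x. graded h 0 x} k x"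
  shows "x = 0"
  using assms(1-3)
  by (intro central_ideal_trivial[OF graded_central_ideal[OF lower_central_graded[OF assms(4)]]])

end

section \<open>Norms with respect to a periodic endomorphism\<close>

locale periodic_endomorphism =
  fixes \<delta> :: "'a::ring_1 \<Rightarrow> 'a" and n :: nat
  assumes endo_one: "\<delta> 1 = 1"
    and endo_add: "\<delta> (x + y) = \<delta> x + \<delta> y"
    and endo_mult: "\<delta> (x * y) = \<delta> x * \<delta> y"
    and period: "\<delta> ^^ n = id"
    and period_pos: "n > 0"
begin

lemma endo_diff: "\<delta> (x - y) = \<delta> x - \<delta> y"
  by (metis add_diff_cancel_right' diff_add_cancel endo_add)

lemma endo_zero: "\<delta> 0 = 0"
  using endo_diff[of 0 0] by simp

lemma endo_bracket: "\<delta> (lie_bracket x y) = lie_bracket (\<delta> x) (\<delta> y)"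
  by (simp add: lie_bracket_def endo_diff endo_mult)

lemma funpow_mult: "(\<delta> ^^ i) (x * y) = (\<delta> ^^ i) x * (\<delta> ^^ i) y"
  by (induction i) (simp_all add: endo_mult)

text \<open>Index 0 is left out so that \<open>f\<close> can stand before this product in the norm
  and after it in the image of the norm.\<close>

definition conjugates :: "'a \<Rightarrow> 'a list"
  where "conjugates f = map (\<lambda>i. (\<delta> ^^ i) f) [1..<n]"

definition orbit_norm :: "'a \<Rightarrow> 'a"
  where "orbit_norm f = f * prod_list (conjugates f)"

lemma prod_list_conjugates_closed:
  assumes "1 \<in> S" "\<And>x y. x \<in> S \<Longrightarrow> y \<in> S \<Longrightarrow> x * y \<in> S" "\<delta> ` S \<subseteq> S" "f \<in> S"
  shows "prod_list (conjugates f) \<in> S"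
proof -
  have "(\<delta> ^^ i) f \<in> S" for i
    using assms by (induction i) auto
  then have "prod_list (map (\<lambda>i. (\<delta> ^^ i) f) xs) \<in> S" for xs
    by (induction xs) (auto intro: assms)
  then show ?thesis
    by (simp add: conjugates_def)
qed

lemma endo_prod_list: "\<delta> (prod_list xs) = prod_list (map \<delta> xs)"
  by (induction xs) (simp_all add: endo_one endo_mult)

lemma endo_norm: "\<delta> (orbit_norm f) = prod_list (conjugates f) * f"
proof -
  \<comment> \<open>The orbit at indices 1 to \<open>n\<close> is the shifted orbit at 0 to
    \<open>n - 1\<close>; its last entry is \<open>f\<close> by periodicity.\<close>
  have "map (\<lambda>i. (\<delta> ^^ i) f) ([1..<n] @ [n]) = map (\<lambda>i. (\<delta> ^^ i) f) (map Suc [0..<n])"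
    using period_pos by (simp add: map_Suc_upt del: map_map)
  also have "\<dots> = \<delta> f # map \<delta> (conjugates f)"
    using period_pos by (simp add: conjugates_def upt_conv_Cons)
  finally have "prod_list (map (\<lambda>i. (\<delta> ^^ i) f) ([1..<n] @ [n])) =
      prod_list (\<delta> f # map \<delta> (conjugates f))"
    by (rule arg_cong)
  then have "prod_list (conjugates f) * f = \<delta> f * prod_list (map \<delta> (conjugates f))"
    by (simp add: conjugates_def period)
  then show ?thesis
    by (simp add: orbit_norm_def endo_mult endo_prod_list)
qed

lemma endo_norm_bracket: "\<delta> (orbit_norm f) = orbit_norm f + lie_bracket (prod_list (conjugates f)) f"
  by (simp add: endo_norm lie_bracket_def) (simp add: orbit_norm_def)

lemma endo_lower_central:
  assumes "lower_central S m x" "\<delta> ` S \<subseteq> S"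
  shows "lower_central S m (\<delta> x)"
  using assms
  by (induction rule: lower_central.induct)
    (auto simp: endo_bracket endo_diff endo_zero intro: lower_central.intros)

text \<open>The induction varies \<open>S\<close>, passing to the subring generated by the norm
  \<open>h\<close> and the commutators. For \<open>k = 1\<close>, \<open>S\<close> is
  commutative.\<close>

lemma iterated_norm_fixed:
  assumes "unital_subring S" "\<delta> ` S \<subseteq> S" "f \<in> S" "k \<ge> 1"
    and "\<And>z. lower_central S k z \<Longrightarrow> z = 0"
  shows "\<delta> ((orbit_norm ^^ k) f) = (orbit_norm ^^ k) f"
  using assms(4,1-3,5)
proof (induction k arbitrary: S f rule: nat_induct_at_least)
  case base
  interpret unital_subring S by fact
  have "prod_list (conjugates f) \<in> S"
    using base(2,3) by (intro prod_list_conjugates_closed one_closed mult_closed)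
  then have "lower_central S 1 (lie_bracket (prod_list (conjugates f)) f)"
    using base(3) by (auto intro: lower_central.intros)
  from base(4)[OF this] show ?case
    by (simp add: endo_norm_bracket)
next
  case (Suc k)
  interpret unital_subring S by fact
  define h where "h = orbit_norm f"
  have prod: "prod_list (conjugates f) \<in> S"
    using Suc.prems(2,3) by (intro prod_list_conjugates_closed one_closed mult_closed)
  then have h: "h \<in> S"
    using Suc.prems(3) by (simp add: h_def orbit_norm_def mult_closed)
  \<comment> \<open>\<open>\<delta> h\<close> differs from \<open>h\<close> by a commutator, so the
    new subring is stable under \<open>\<delta>\<close> although \<open>h\<close> need not be
    fixed.\<close>
  have "lower_central S (Suc 0) (lie_bracket (prod_list (conjugates f)) f)"
    using prod Suc.prems(3) by (intro lower_central.intros)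
  then have endo_h: "graded h 0 (\<delta> h)"
    by (simp add: h_def endo_norm_bracket graded_add graded.self graded.lower_central)
  have "graded h j (\<delta> x)" if "graded h j x" for j x
    using that
  proof (induction rule: graded.induct)
    case (lower_central j z)
    then show ?case
      by (intro graded.lower_central endo_lower_central Suc.prems)
  qed (simp_all add: endo_one endo_mult endo_diff endo_h graded.one graded.mult graded.diff)
  then have "\<delta> ((orbit_norm ^^ k) h) = (orbit_norm ^^ k) h"
  proof (intro Suc.IH[of "{x. graded h 0 x}"] unital_subring_graded)
    show "z = 0" if "lower_central {x. graded h 0 x} k z" for z
      using Suc.hyps by (intro lower_central_graded_trivial[OF Suc.prems(4) _ h that]) simp_all
  qed (auto intro: graded.self)
  then show ?case
    by (simp add: h_def funpow_Suc_right del: funpow.simps)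
qed

text \<open>
  The iterated norm begins with \<open>f\<close>, and its image under \<open>\<delta>\<^sup>k\<close> ends with \<open>f\<close>: this yields
  the integral equations with coefficients on either side. The predicate \<open>D d\<close> stands for
  ``polynomial of degree at most \<open>d\<close>''.
\<close>

lemma iterated_norm_factors:
  assumes D: "D 0 1" "\<And>i j x y. D i x \<Longrightarrow> D j y \<Longrightarrow> D (i + j) (x * y)" "\<And>i x. D i x \<Longrightarrow> D i (\<delta> x)"
    and "D 1 f"
  shows "D (n ^ k) ((orbit_norm ^^ k) f)
    \<and> (\<exists>g. D (n ^ k - 1) g \<and> (orbit_norm ^^ k) f = f * g)
    \<and> (\<exists>g. D (n ^ k - 1) g \<and> (\<delta> ^^ k) ((orbit_norm ^^ k) f) = g * f)"
proof (induction k)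
  case 0
  then show ?case
    using assms(1,4) by simp (metis mult_1 mult.right_neutral)
next
  case (Suc k)
  define h where "h = (orbit_norm ^^ k) f"
  define p where "p = prod_list (conjugates h)"
  from Suc obtain g g' where g: "D (n ^ k) h" "D (n ^ k - 1) g" "h = f * g"
    "D (n ^ k - 1) g'" "(\<delta> ^^ k) h = g' * f"
    unfolding h_def by blast
  have endo: "D i ((\<delta> ^^ m) x)" if "D i x" for i m x
    using that by (induction m) (simp_all add: D(3))
  have "D (n ^ k * length xs) (prod_list (map (\<lambda>i. (\<delta> ^^ i) h) xs))" for xs
    by (induction xs) (simp_all add: D(1) D(2)[OF endo[OF g(1)]])
  from this[of "[1..<n]"] have p: "D (n ^ k * (n - 1)) p"
    by (simp add: p_def conjugates_def)
  obtain m where n: "n = Suc m"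
    using period_pos by (cases n) auto
  have "n ^ k > 0"
    using period_pos by simp
  then have deg: "n ^ k + n ^ k * (n - 1) = n ^ Suc k"
    "n ^ k - 1 + n ^ k * (n - 1) = n ^ Suc k - 1"
    "n ^ k * (n - 1) + (n ^ k - 1) = n ^ Suc k - 1"
    unfolding n by (simp_all add: mult.commute)
  have Suc_k: "(orbit_norm ^^ Suc k) f = orbit_norm h"
    by (simp add: h_def)
  have norm: "orbit_norm h = h * p"
    by (simp add: p_def orbit_norm_def)
  \<comment> \<open>One application of \<open>\<delta>\<close> rotates \<open>h\<close> to the end;
    the other \<open>k\<close> expose its final factor \<open>f\<close>.\<close>
  have "(\<delta> ^^ Suc k) (orbit_norm h) = (\<delta> ^^ k) (p * h)"
    by (simp add: funpow_Suc_right endo_norm p_def del: funpow.simps)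
  also have "\<dots> = ((\<delta> ^^ k) p * g') * f"
    by (simp only: funpow_mult g(5) mult.assoc)
  finally have end_norm: "(\<delta> ^^ Suc k) (h * p) = ((\<delta> ^^ k) p * g') * f"
    unfolding norm .
  have "D (n ^ Suc k) (h * p)" "D (n ^ Suc k - 1) (g * p)" "D (n ^ Suc k - 1) ((\<delta> ^^ k) p * g')"
    using D(2)[OF g(1) p] D(2)[OF g(2) p] D(2)[OF endo[OF p] g(4)] unfolding deg .
  moreover have "h * p = f * (g * p)"
    by (subst g(3)) (rule mult.assoc)
  ultimately show ?case
    using end_norm unfolding Suc_k norm by blast
qed

text \<open>Serves for the property of having constant coefficient 1.\<close>

lemma iterated_norm_closed:
  assumes "P 1" "\<And>x y. P x \<Longrightarrow> P y \<Longrightarrow> P (x * y)" "\<And>x. P x \<Longrightarrow> P (\<delta> x)" "P f"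
  shows "P ((orbit_norm ^^ k) f)"
proof (induction k)
  case (Suc k)
  have "prod_list (conjugates ((orbit_norm ^^ k) f)) \<in> Collect P"
    using assms Suc by (intro prod_list_conjugates_closed) auto
  with Suc show ?case
    using assms(2) by (simp add: orbit_norm_def[of "(orbit_norm ^^ k) f"])
qed (simp add: assms)

end

section \<open>Power series\<close>

unbundle fps_syntax

text \<open>Transfers Lie nilpotency to the power series ring.\<close>

lemma lower_central_fps:
  assumes "lower_central UNIV m F"
  shows "lower_central UNIV m (F $ i)"
  using assms
proof (induction arbitrary: i rule: lower_central.induct)
  case (bracket m u x)
  \<comment> \<open>Summed backwards, so that both products pair \<open>u $ j\<close> with
    \<open>x $ (i - j)\<close>.\<close>
  have "(x * u) $ i = (\<Sum>j=0..i. x $ (i - j) * u $ j)"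
    unfolding fps_mult_nth by (rule sum.reindex_bij_witness[of _ "\<lambda>j. i - j" "\<lambda>j. i - j"]) auto
  then have "lie_bracket u x $ i = (\<Sum>j=0..i. lie_bracket (u $ j) (x $ (i - j)))"
    by (simp add: lie_bracket_def fps_mult_nth sum_subtractf)
  then show ?case
    by (auto intro!: lower_central_sum lower_central.bracket bracket.IH)
qed (auto intro: lower_central.intros)

definition fps_map :: "('a \<Rightarrow> 'b) \<Rightarrow> 'a fps \<Rightarrow> 'b fps"
  where "fps_map f F = Abs_fps (\<lambda>i. f (F $ i))"

lemma fps_map_nth [simp]: "fps_map f F $ i = f (F $ i)"
  by (simp add: fps_map_def)

lemma fps_map_funpow_nth:
  fixes f :: "'a \<Rightarrow> 'a"
  shows "(fps_map f ^^ m) F $ i = (f ^^ m) (F $ i)"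
  by (induction m) simp_all

lemma periodic_endomorphism_fps_map:
  assumes "periodic_endomorphism \<delta> n"
  shows "periodic_endomorphism (fps_map \<delta>) n"
proof -
  interpret periodic_endomorphism \<delta> n by fact
  have sum: "\<delta> (sum g A) = (\<Sum>i\<in>A. \<delta> (g i))" for g :: "nat \<Rightarrow> 'a" and A
    by (induction A rule: infinite_finite_induct) (auto simp: endo_zero endo_add)
  show ?thesis
    by unfold_locales
      (auto simp: fps_eq_iff endo_one endo_zero endo_add endo_mult sum fps_mult_nth
        fps_map_funpow_nth period period_pos)
qed

definition fps_degree_le :: "nat \<Rightarrow> 'a::zero fps \<Rightarrow> bool"
  where "fps_degree_le d F \<longleftrightarrow> (\<forall>i>d. F $ i = 0)"

lemma fps_degree_le_mult:
  fixes F G :: "'a::ring_1 fps"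
  assumes "fps_degree_le d F" "fps_degree_le d' G"
  shows "fps_degree_le (d + d') (F * G)"
  unfolding fps_degree_le_def fps_mult_nth
proof (intro allI impI sum.neutral ballI)
  fix i j assume "i > d + d'" "j \<in> {0..i}"
  then have "j > d \<or> i - j > d'"
    by auto
  then show "F $ j * G $ (i - j) = 0"
    using assms by (auto simp: fps_degree_le_def)
qed

text \<open>The sum is the coefficient of \<open>X^d\<close> in \<open>(1 - r X)^(-1) * P\<close>,
  the inverse being a geometric series.\<close>

lemma sum_power_left_factor:
  fixes G :: "'a::ring_1 fps"
  assumes "P = (1 - fps_const r * fps_X) * G"
  shows "(\<Sum>i\<le>d. r ^ i * P $ (d - i)) = G $ d"
proof (induction d)
  case 0
  then show ?case
    by (simp add: assms)
next
  case (Suc d)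
  have "P $ Suc d = G $ Suc d - r * G $ d"
    by (simp add: assms algebra_simps)
  with Suc show ?case
    by (subst sum.atMost_Suc_shift) (simp add: mult.assoc flip: sum_distrib_left)
qed

lemma sum_power_right_factor:
  fixes G :: "'a::ring_1 fps"
  assumes "P = G * (1 - fps_const r * fps_X)"
  shows "(\<Sum>i\<le>d. P $ (d - i) * r ^ i) = G $ d"
proof (induction d)
  case 0
  then show ?case
    by (simp add: assms)
next
  case (Suc d)
  have "P $ Suc d = G $ Suc d - G $ d * r"
    by (simp add: assms algebra_simps flip: mult.assoc)
  with Suc show ?case
    by (subst sum.atMost_Suc_shift)
      (simp add: power_Suc2 del: power_Suc flip: sum_distrib_right mult.assoc)
qed

section \<open>Integrality over the fixed ring\<close>

theorem theorem4p5:
  fixes scale :: "'k::field_char_0 \<Rightarrow> 'a::ring_1 \<Rightarrow> 'a"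
    and e :: 'k and \<delta> :: "'a \<Rightarrow> 'a" and n k :: nat
  assumes "unital_algebra scale"
    and "k \<ge> 1" and "lie_nilpotent TYPE('a) k"
    and "n \<ge> 1" and "primitive_root_of_unity n e"
    and "algebra_automorphism scale \<delta>" and "\<delta> ^^ n = id"
  shows "right_integral_of_degree (Fix \<delta>) (n ^ k)
    \<and> left_integral_of_degree (Fix \<delta>) (n ^ k)"
proof -
  have "periodic_endomorphism \<delta> n"
    using assms by unfold_locales (auto simp: algebra_automorphism_def ring_automorphism_def)
  then interpret periodic_endomorphism \<delta> n .
  interpret fps: periodic_endomorphism "fps_map \<delta>" n
    by (rule periodic_endomorphism_fps_map) fact
  let ?d = "n ^ k"
  have "\<exists>c. (\<forall>i<?d. c i \<in> Fix \<delta>) \<and> (\<Sum>i<?d. r ^ i * c i) + r ^ ?d = 0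
      \<and> (\<Sum>i<?d. c i * r ^ i) + r ^ ?d = 0" for r :: 'a
  proof -
    define f where "f = 1 - fps_const r * fps_X"
    define P where "P = (fps.orbit_norm ^^ k) f"
    have fixed: "fps_map \<delta> P = P"
      unfolding P_def
    proof (rule fps.iterated_norm_fixed[where S = UNIV])
      show "z = 0" if "lower_central UNIV k z" for z :: "'a fps"
        using lower_central_fps[OF that] lower_central_lie_nilpotent[OF assms(3)]
        by (auto simp: fps_eq_iff)
    qed (use assms in \<open>auto intro: unital_subring.intro\<close>)
    \<comment> \<open>Hence the right factorisation is one of \<open>P\<close> itself, and the same
      coefficients serve both sides.\<close>
    then have iter: "(fps_map \<delta> ^^ k) P = P"
      by (induction k) auto
    have "fps_degree_le (n ^ k) P \<and> (\<exists>g. fps_degree_le (?d - 1) g \<and> P = f * g)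
        \<and> (\<exists>g. fps_degree_le (?d - 1) g \<and> (fps_map \<delta> ^^ k) P = g * f)"
      unfolding P_def
    proof (rule fps.iterated_norm_factors)
      show "fps_degree_le 1 f"
        by (auto simp: fps_degree_le_def f_def)
      show "fps_degree_le (i + j) (x * y)" if "fps_degree_le i x" "fps_degree_le j y"
        for i j and x y :: "'a fps"
        using that by (rule fps_degree_le_mult)
    qed (auto simp: fps_degree_le_def endo_zero)
    then obtain g g' where g: "fps_degree_le (?d - 1) g" "P = f * g"
      "fps_degree_le (?d - 1) g'" "P = g' * f"
      unfolding iter by blast
    \<comment> \<open>This becomes the leading coefficient of the reversal. The cofactors have
      degree below \<open>n ^ k\<close>, so both sums vanish.\<close>
    have "P $ 0 = 1"
      unfolding P_def by (rule fps.iterated_norm_closed) (auto simp: endo_one f_def)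
    moreover have "g $ ?d = 0" "g' $ ?d = 0"
      using g assms(4) by (auto simp: fps_degree_le_def)
    ultimately have "(\<Sum>i<?d. r ^ i * P $ (?d - i)) + r ^ ?d = 0"
      "(\<Sum>i<?d. P $ (?d - i) * r ^ i) + r ^ ?d = 0"
      using sum_power_left_factor[OF g(2)[unfolded f_def], of ?d]
        sum_power_right_factor[OF g(4)[unfolded f_def], of ?d]
      by (simp_all flip: lessThan_Suc_atMost)
    moreover have "P $ i \<in> Fix \<delta>" for i
      using arg_cong[OF fixed, of "\<lambda>F. F $ i"] by (simp add: Fix_def)
    ultimately show ?thesis
      by (intro exI[of _ "\<lambda>i. P $ (?d - i)"]) simp
  qed
  then show ?thesis
    unfolding right_integral_of_degree_def left_integral_of_degree_def by blast
qed

end
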